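(* Let $G$ be a non-abelian finite group, let $p$ be the smallest prime number dividing the order of $G$, and suppose that $Z^{\wedge}(G)$ is a proper subgroup of $Z(G)$. Then for all $n\ge 1$, $$D^{\wedge}_n(G)\leq\frac{p^{2n+1}(p+1)+p^{2n}-1}{p^{3n+1}(p+1)}.$$
   Context: For a group $G$ write ${}^hg=hgh^{-1}$. The tensor square $G\otimes G$ is the group generated by symbols $g\otimes h$ ($g,h\in G$) subject to $gk\otimes h=({}^gk\otimes {}^gh)(g\otimes h)$ and $g\otimes hk=(g\otimes h)({}^hg\otimes {}^hk)$ for all $g,h,k\in G$. The exterior square $G\wedge G$ is the quotient of $G\otimes G$ obtained by imposing the additional relations $g\otimes g=1$ for all $g\in G$; the image of $x\otimes y$ is denoted $x\wedge y$. For $x\in G$, the exterior centralizer is the subgroup $C^{\wedge}_G(x)=\{y\in G: x\wedge y=1\}$, and the exterior center is $Z^{\wedge}(G)=\bigcap_{x\in G}C^{\wedge}_G(x)$. $Z(G)$ is the center of $G$. For a finite group $G$ and an integer $n\ge 0$, the multiple exterior degree is $$D^{\wedge}_n(G)=\frac{|\{(x_1,\dots,x_{n+1})\in G^{n+1}: x_i\wedge x_j=1 \text{ in } G\wedge G \text{ for all } 1\le i,j\le n+1\}|}{|G|^{n+1}}.$$ *)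

theory Defs
  imports "HOL-Algebra.Algebra" Complex_Main
begin

section \<open>Groups given by generators and relations\<close>

text \<open>
  Words over \<open>S\<close> are lists of signed letters: \<open>(a, True)\<close> stands for the generator \<open>a\<close> and
  \<open>(a, False)\<close> for its formal inverse.  A pair \<open>(u, v) \<in> R\<close> stands for the relation \<open>u = v\<close>.
\<close>

type_synonym 'g word = "('g \<times> bool) list"

definition words :: "'g set \<Rightarrow> 'g word set" where
  "words S = lists (S \<times> UNIV)"

inductive_set pres_cong :: "'g set \<Rightarrow> ('g word \<times> 'g word) set \<Rightarrow> ('g word \<times> 'g word) set"
  for S :: "'g set" and R :: "('g word \<times> 'g word) set"
where
  refl: "w \<in> words S \<Longrightarrow> (w, w) \<in> pres_cong S R"
| sym: "(u, v) \<in> pres_cong S R \<Longrightarrow> (v, u) \<in> pres_cong S R"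
| trans: "(u, v) \<in> pres_cong S R \<Longrightarrow> (v, w) \<in> pres_cong S R \<Longrightarrow> (u, w) \<in> pres_cong S R"
| app: "(u, u') \<in> pres_cong S R \<Longrightarrow> (v, v') \<in> pres_cong S R \<Longrightarrow> (u @ v, u' @ v') \<in> pres_cong S R"
| cancel: "a \<in> S \<Longrightarrow> ([(a, b), (a, \<not> b)], []) \<in> pres_cong S R"
| rel: "(u, v) \<in> R \<Longrightarrow> u \<in> words S \<Longrightarrow> v \<in> words S \<Longrightarrow> (u, v) \<in> pres_cong S R"

definition presented_group :: "'g set \<Rightarrow> ('g word \<times> 'g word) set \<Rightarrow> 'g word set monoid" where
  "presented_group S R =
     \<lparr>carrier = words S // pres_cong S R,
      monoid.mult = (\<lambda>A B. \<Union>u\<in>A. \<Union>v\<in>B. pres_cong S R `` {u @ v}),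
      monoid.one = pres_cong S R `` {[]}\<rparr>"

definition pres_gen :: "'g set \<Rightarrow> ('g word \<times> 'g word) set \<Rightarrow> 'g \<Rightarrow> 'g word set" where
  "pres_gen S R a = pres_cong S R `` {[(a, True)]}"

lemma words_append [simp]: "u @ v \<in> words S \<longleftrightarrow> u \<in> words S \<and> v \<in> words S"
  by (auto simp: words_def)

lemma words_Nil [simp]: "[] \<in> words S"
  by (simp add: words_def)

lemma words_Cons [simp]: "(a, b) # w \<in> words S \<longleftrightarrow> a \<in> S \<and> w \<in> words S"
  by (auto simp: words_def)

lemma pres_cong_words:
  assumes "(u, v) \<in> pres_cong S R"
  shows "u \<in> words S \<and> v \<in> words S"
  using assms by induction auto

lemma equiv_pres_cong: "equiv (words S) (pres_cong S R)"
proof (rule equivI)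
  show "pres_cong S R \<subseteq> words S \<times> words S"
    by (auto dest: pres_cong_words)
  show "refl_on (words S) (pres_cong S R)"
    by (auto simp: refl_on_def intro: pres_cong.refl)
  show "Relation.sym (pres_cong S R)"
    by (auto intro: symI pres_cong.sym)
  show "Relation.trans (pres_cong S R)"
    by (auto intro: transI pres_cong.trans)
qed

lemma pres_class_eq_iff:
  assumes "u \<in> words S" "v \<in> words S"
  shows "pres_cong S R `` {u} = pres_cong S R `` {v} \<longleftrightarrow> (u, v) \<in> pres_cong S R"
  using eq_equiv_class_iff[OF equiv_pres_cong assms] .

lemma pres_class_in_carrier:
  "w \<in> words S \<Longrightarrow> pres_cong S R `` {w} \<in> carrier (presented_group S R)"
  by (simp add: presented_group_def quotientI)

lemma presented_group_cases:
  assumes "A \<in> carrier (presented_group S R)"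
  obtains w where "w \<in> words S" "A = pres_cong S R `` {w}"
  using assms by (auto simp: presented_group_def elim: quotientE)

lemma presented_group_one: "\<one>\<^bsub>presented_group S R\<^esub> = pres_cong S R `` {[]}"
  by (simp add: presented_group_def)

lemma presented_group_mult:
  assumes "u \<in> words S" "v \<in> words S"
  shows "pres_cong S R `` {u} \<otimes>\<^bsub>presented_group S R\<^esub> pres_cong S R `` {v} = pres_cong S R `` {u @ v}"
proof -
  let ?A = "pres_cong S R `` {u}" and ?B = "pres_cong S R `` {v}" and ?C = "pres_cong S R `` {u @ v}"
  have C: "pres_cong S R `` {u' @ v'} = ?C" if "u' \<in> ?A" "v' \<in> ?B" for u' v'
  proof -
    have "(u @ v, u' @ v') \<in> pres_cong S R"
      using that by (intro pres_cong.app) simp_all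
    then show ?thesis
      using equiv_class_eq[OF equiv_pres_cong] by metis
  qed
  have "u \<in> ?A" "v \<in> ?B"
    using assms by (simp_all add: pres_cong.refl)
  then have ne: "?A \<noteq> {}" "?B \<noteq> {}"
    by (metis empty_iff)+
  have "(\<Union>u'\<in>?A. \<Union>v'\<in>?B. pres_cong S R `` {u' @ v'}) = (\<Union>u'\<in>?A. \<Union>v'\<in>?B. ?C)"
    using C by (intro SUP_cong HOL.refl)
  also have "\<dots> = ?C"
    using ne by (simp only: UN_constant if_False)
  finally show ?thesis
    by (simp only: presented_group_def monoid.simps)
qed

definition word_inv :: "'g word \<Rightarrow> 'g word" where
  "word_inv w = rev (map (\<lambda>(a, b). (a, \<not> b)) w)"

lemma word_inv_words [simp]: "word_inv w \<in> words S \<longleftrightarrow> w \<in> words S"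
  by (induction w) (auto simp: word_inv_def)

lemma word_inv_cancel: "w \<in> words S \<Longrightarrow> (word_inv w @ w, []) \<in> pres_cong S R"
proof (induction w)
  case Nil
  then show ?case by (simp add: word_inv_def pres_cong.refl)
next
  case (Cons x w)
  obtain a b where x: "x = (a, b)" by fastforce
  have a: "a \<in> S" and w: "w \<in> words S" using Cons.prems x by auto
  have "([(a, \<not> b), (a, b)], []) \<in> pres_cong S R"
    using pres_cong.cancel[OF a, of "\<not> b"] by simp
  then have "([(a, \<not> b), (a, b)] @ w, [] @ w) \<in> pres_cong S R"
    by (rule pres_cong.app[OF _ pres_cong.refl[OF w]])
  then have "(word_inv w @ ([(a, \<not> b), (a, b)] @ w), word_inv w @ ([] @ w)) \<in> pres_cong S R"
    by (rule pres_cong.app[OF pres_cong.refl, rotated]) (simp add: w)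
  then show ?case
    using Cons.IH[OF w] pres_cong.trans by (fastforce simp: x word_inv_def)
qed

lemma group_presented_group: "group (presented_group S R)"
proof (rule groupI)
  let ?P = "presented_group S R"
  show "\<one>\<^bsub>?P\<^esub> \<in> carrier ?P"
    by (simp add: presented_group_one pres_class_in_carrier)
  fix x y z
  assume x: "x \<in> carrier ?P"
  obtain u where u: "u \<in> words S" "x = pres_cong S R `` {u}"
    using x by (rule presented_group_cases)
  show "\<one>\<^bsub>?P\<^esub> \<otimes>\<^bsub>?P\<^esub> x = x"
    by (simp add: u presented_group_one presented_group_mult)
  have "pres_cong S R `` {word_inv u} \<otimes>\<^bsub>?P\<^esub> x = \<one>\<^bsub>?P\<^esub>"
    using u word_inv_cancel[OF u(1)]
    by (simp add: presented_group_one presented_group_mult pres_class_eq_iff)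
  then show "\<exists>y\<in>carrier ?P. y \<otimes>\<^bsub>?P\<^esub> x = \<one>\<^bsub>?P\<^esub>"
    using u pres_class_in_carrier[of "word_inv u" S R] by auto
  assume y: "y \<in> carrier ?P"
  obtain v where v: "v \<in> words S" "y = pres_cong S R `` {v}"
    using y by (rule presented_group_cases)
  show "x \<otimes>\<^bsub>?P\<^esub> y \<in> carrier ?P"
    by (simp add: u v presented_group_mult pres_class_in_carrier)
  assume z: "z \<in> carrier ?P"
  obtain w where w: "w \<in> words S" "z = pres_cong S R `` {w}"
    using z by (rule presented_group_cases)
  show "x \<otimes>\<^bsub>?P\<^esub> y \<otimes>\<^bsub>?P\<^esub> z = x \<otimes>\<^bsub>?P\<^esub> (y \<otimes>\<^bsub>?P\<^esub> z)"
    by (simp add: u v w presented_group_mult)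
qed

fun word_eval :: "('c, 'd) monoid_scheme \<Rightarrow> ('g \<Rightarrow> 'c) \<Rightarrow> 'g word \<Rightarrow> 'c" where
  "word_eval H f [] = \<one>\<^bsub>H\<^esub>"
| "word_eval H f ((a, b) # w) = (if b then f a else inv\<^bsub>H\<^esub> (f a)) \<otimes>\<^bsub>H\<^esub> word_eval H f w"

lemma (in group) word_eval_closed:
  assumes "f \<in> S \<rightarrow> carrier G" "w \<in> words S"
  shows "word_eval G f w \<in> carrier G"
  using assms(2)
proof (induction w)
  case (Cons x w)
  then show ?case using assms(1) by (cases x) (auto simp: Pi_iff)
qed simp

lemma (in group) word_eval_append:
  assumes "f \<in> S \<rightarrow> carrier G" "u \<in> words S" "v \<in> words S"
  shows "word_eval G f (u @ v) = word_eval G f u \<otimes> word_eval G f v"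
  using assms(2)
proof (induction u)
  case Nil
  then show ?case using word_eval_closed[OF assms(1,3)] by simp
next
  case (Cons x u)
  obtain a b where x: "x = (a, b)" by fastforce
  have "a \<in> S" and u: "u \<in> words S" using Cons.prems x by auto
  then have "f a \<in> carrier G" using assms(1) by auto
  then show ?case
    using Cons.IH[OF u] word_eval_closed[OF assms(1) u] word_eval_closed[OF assms(1,3)]
    by (simp add: x m_assoc)
qed

lemma (in group) word_eval_cong:
  assumes f: "f \<in> S \<rightarrow> carrier G"
    and R: "\<And>u v. (u, v) \<in> R \<Longrightarrow> word_eval G f u = word_eval G f v"
    and "(u, v) \<in> pres_cong S R"
  shows "word_eval G f u = word_eval G f v"
  using assms(3)
proof induction
  case (app u u' v v')
  then show ?case
    using pres_cong_words[OF app.hyps(1)] pres_cong_words[OF app.hyps(2)]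
    by (simp add: word_eval_append[OF f])
next
  case (cancel a b)
  then have "f a \<in> carrier G" using f by auto
  then show ?case by simp
qed (simp_all add: R)

text \<open>The universal property of the presented group.\<close>

lemma (in group) presented_group_hom:
  assumes f: "f \<in> S \<rightarrow> carrier G"
    and R: "\<And>u v. (u, v) \<in> R \<Longrightarrow> word_eval G f u = word_eval G f v"
  shows "\<exists>\<phi> \<in> hom (presented_group S R) G. \<forall>a\<in>S. \<phi> (pres_gen S R a) = f a"
proof -
  define \<phi> where "\<phi> A = word_eval G f (SOME w. w \<in> A)" for A
  have \<phi>: "\<phi> (pres_cong S R `` {w}) = word_eval G f w" if w: "w \<in> words S" for w
  proof -
    have "w \<in> pres_cong S R `` {w}" using w by (auto intro: pres_cong.refl)
    then have "(SOME w'. w' \<in> pres_cong S R `` {w}) \<in> pres_cong S R `` {w}"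
      by (rule someI)
    then show ?thesis
      using word_eval_cong[of f S R, OF f R] unfolding \<phi>_def by fastforce
  qed
  have "\<phi> \<in> hom (presented_group S R) G"
  proof (rule homI)
    fix x assume "x \<in> carrier (presented_group S R)"
    then obtain u where "u \<in> words S" "x = pres_cong S R `` {u}"
      by (rule presented_group_cases)
    then show "\<phi> x \<in> carrier G" using \<phi> word_eval_closed[OF f] by simp
  next
    fix x y
    assume x: "x \<in> carrier (presented_group S R)" and y: "y \<in> carrier (presented_group S R)"
    obtain u where u: "u \<in> words S" "x = pres_cong S R `` {u}"
      using x by (rule presented_group_cases)
    obtain v where v: "v \<in> words S" "y = pres_cong S R `` {v}"
      using y by (rule presented_group_cases)
    show "\<phi> (x \<otimes>\<^bsub>presented_group S R\<^esub> y) = \<phi> x \<otimes> \<phi> y"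
      using u v by (simp add: presented_group_mult \<phi> word_eval_append[OF f])
  qed
  moreover have "\<phi> (pres_gen S R a) = f a" if "a \<in> S" for a
    using that f \<phi>[of "[(a, True)]"] by (auto simp: pres_gen_def Pi_iff)
  ultimately show ?thesis by blast
qed

definition normal_closure :: "('a, 'b) monoid_scheme \<Rightarrow> 'a set \<Rightarrow> 'a set" where
  "normal_closure G S = \<Inter>{N. N \<lhd> G \<and> S \<subseteq> N}"

lemma (in group) normal_closure_normal:
  assumes "S \<subseteq> carrier G"
  shows "normal_closure G S \<lhd> G"
proof -
  let ?\<N> = "{N. N \<lhd> G \<and> S \<subseteq> N}"
  have "carrier G \<lhd> G"
    by (rule normal_invI[OF subgroup_self]) simp
  then have ne: "?\<N> \<noteq> {}" using assms by blast
  have sub: "subgroup (\<Inter>?\<N>) G"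
    using ne by (intro subgroups_Inter) (auto dest: normal_imp_subgroup)
  show ?thesis
    unfolding normal_closure_def
  proof (rule normal_invI[OF sub])
    fix x h assume "x \<in> carrier G" "h \<in> \<Inter>?\<N>"
    then show "x \<otimes> h \<otimes> inv x \<in> \<Inter>?\<N>"
      by (auto intro: normal.inv_op_closed2)
  qed
qed

lemma normal_closure_superset: "S \<subseteq> normal_closure G S"
  by (auto simp: normal_closure_def)

section \<open>Tensor square and exterior square\<close>

text \<open>
  The letter \<open>(g, h)\<close> is the symbol \<open>g \<otimes> h\<close> of the tensor square, and \<open>conj_by G h g\<close> is
  \<open>h g (inv h)\<close>.  The exterior square is the quotient of the tensor square by the normal closure of
  the diagonal elements \<open>g \<otimes> g\<close>, and \<open>x \<and> y\<close> is the coset of \<open>x \<otimes> y\<close>.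
\<close>

definition conj_by :: "('a, 'b) monoid_scheme \<Rightarrow> 'a \<Rightarrow> 'a \<Rightarrow> 'a" where
  "conj_by G h g = h \<otimes>\<^bsub>G\<^esub> g \<otimes>\<^bsub>G\<^esub> inv\<^bsub>G\<^esub> h"

definition tensor_relations :: "('a, 'b) monoid_scheme \<Rightarrow> (('a \<times> 'a) word \<times> ('a \<times> 'a) word) set" where
  "tensor_relations G =
     {([((g \<otimes>\<^bsub>G\<^esub> k, h), True)], [((conj_by G g k, conj_by G g h), True), ((g, h), True)])
        | g h k. g \<in> carrier G \<and> h \<in> carrier G \<and> k \<in> carrier G} \<union>
     {([((g, h \<otimes>\<^bsub>G\<^esub> k), True)], [((g, h), True), ((conj_by G h g, conj_by G h k), True)])
        | g h k. g \<in> carrier G \<and> h \<in> carrier G \<and> k \<in> carrier G}"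

definition tensor_square :: "('a, 'b) monoid_scheme \<Rightarrow> ('a \<times> 'a) word set monoid" where
  "tensor_square G = presented_group (carrier G \<times> carrier G) (tensor_relations G)"

definition tensor :: "('a, 'b) monoid_scheme \<Rightarrow> 'a \<Rightarrow> 'a \<Rightarrow> ('a \<times> 'a) word set" where
  "tensor G g h = pres_gen (carrier G \<times> carrier G) (tensor_relations G) (g, h)"

definition diagonal_closure :: "('a, 'b) monoid_scheme \<Rightarrow> ('a \<times> 'a) word set set" where
  "diagonal_closure G = normal_closure (tensor_square G) {tensor G g g | g. g \<in> carrier G}"

definition exterior_square :: "('a, 'b) monoid_scheme \<Rightarrow> ('a \<times> 'a) word set set monoid" where
  "exterior_square G = tensor_square G Mod diagonal_closure G"

definition wedge :: "('a, 'b) monoid_scheme \<Rightarrow> 'a \<Rightarrow> 'a \<Rightarrow> ('a \<times> 'a) word set set" where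
  "wedge G x y = diagonal_closure G #>\<^bsub>tensor_square G\<^esub> tensor G x y"

lemma conj_by_closed:
  "group G \<Longrightarrow> h \<in> carrier G \<Longrightarrow> g \<in> carrier G \<Longrightarrow> conj_by G h g \<in> carrier G"
  by (simp add: conj_by_def group.is_monoid monoid.m_closed group.inv_closed)

lemma group_tensor_square: "group (tensor_square G)"
  unfolding tensor_square_def by (rule group_presented_group)

lemma tensor_closed:
  "g \<in> carrier G \<Longrightarrow> h \<in> carrier G \<Longrightarrow> tensor G g h \<in> carrier (tensor_square G)"
  unfolding tensor_def tensor_square_def pres_gen_def by (rule pres_class_in_carrier) simp

lemma tensor_mult_left:
  assumes G: "group G" and ghk: "g \<in> carrier G" "h \<in> carrier G" "k \<in> carrier G"
  shows "tensor G (g \<otimes>\<^bsub>G\<^esub> k) h =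
    tensor G (conj_by G g k) (conj_by G g h) \<otimes>\<^bsub>tensor_square G\<^esub> tensor G g h"
proof -
  have "([((g \<otimes>\<^bsub>G\<^esub> k, h), True)], [((conj_by G g k, conj_by G g h), True), ((g, h), True)])
      \<in> tensor_relations G"
    unfolding tensor_relations_def using ghk by blast
  then show ?thesis
    using ghk conj_by_closed[OF G]
    by (simp add: tensor_def tensor_square_def pres_gen_def presented_group_mult
        pres_class_eq_iff pres_cong.rel G group.is_monoid monoid.m_closed)
qed

lemma tensor_mult_right:
  assumes G: "group G" and ghk: "g \<in> carrier G" "h \<in> carrier G" "k \<in> carrier G"
  shows "tensor G g (h \<otimes>\<^bsub>G\<^esub> k) =
    tensor G g h \<otimes>\<^bsub>tensor_square G\<^esub> tensor G (conj_by G h g) (conj_by G h k)"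
proof -
  have "([((g, h \<otimes>\<^bsub>G\<^esub> k), True)], [((g, h), True), ((conj_by G h g, conj_by G h k), True)])
      \<in> tensor_relations G"
    unfolding tensor_relations_def using ghk by blast
  then show ?thesis
    using ghk conj_by_closed[OF G]
    by (simp add: tensor_def tensor_square_def pres_gen_def presented_group_mult
        pres_class_eq_iff pres_cong.rel G group.is_monoid monoid.m_closed)
qed

lemma diagonal_closure_normal: "diagonal_closure G \<lhd> tensor_square G"
  unfolding diagonal_closure_def
  by (rule group.normal_closure_normal[OF group_tensor_square]) (auto intro: tensor_closed)

lemma group_exterior_square: "group (exterior_square G)"
  unfolding exterior_square_def by (rule normal.factorgroup_is_group[OF diagonal_closure_normal])

section \<open>Exterior center and multiple exterior degree\<close>

definition group_center :: "('a, 'b) monoid_scheme \<Rightarrow> 'a set" where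
  "group_center G = {z \<in> carrier G. \<forall>x\<in>carrier G. z \<otimes>\<^bsub>G\<^esub> x = x \<otimes>\<^bsub>G\<^esub> z}"

definition exterior_centralizer :: "('a, 'b) monoid_scheme \<Rightarrow> 'a \<Rightarrow> 'a set" where
  "exterior_centralizer G x = {y \<in> carrier G. wedge G x y = \<one>\<^bsub>exterior_square G\<^esub>}"

definition exterior_center :: "('a, 'b) monoid_scheme \<Rightarrow> 'a set" where
  "exterior_center G = (\<Inter>x\<in>carrier G. exterior_centralizer G x)"

definition multiple_exterior_degree :: "nat \<Rightarrow> ('a, 'b) monoid_scheme \<Rightarrow> real" where
  "multiple_exterior_degree n G =
     real (card {x \<in> {1..n+1} \<rightarrow>\<^sub>E carrier G.
                   \<forall>i\<in>{1..n+1}. \<forall>j\<in>{1..n+1}. wedge G (x i) (x j) = \<one>\<^bsub>exterior_square G\<^esub>})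
     / real (order G) ^ (n + 1)"

end

theory Submission
  imports Defs
begin

text \<open>
  Write \<open>Z\<close> for the exterior center, \<open>z = |Z| / |G|\<close>, and \<open>D n\<close> for the multiple exterior degree.
  Fix the last entry \<open>a\<close> of a tuple whose entries have pairwise trivial wedge.  If \<open>a\<close> lies in \<open>Z\<close>,
  the other entries form an arbitrary shorter tuple of the same kind.  Otherwise they all lie in
  \<open>{y. y \<and> a = 1}\<close>, a proper subgroup of \<open>G\<close>, whose index is at least \<open>p\<close> because an index other
  than 1 has a prime factor dividing \<open>|G|\<close>.  Bounding the number of choices in the second case by
  the full power of that subgroup gives
  \<open>D (n + 1) \<le> z * D n + (1 - z) / p ^ (n + 1)\<close> and \<open>D 0 = 1\<close>.

  In the chain of exterior center, center, centralizer of a noncentral element, and \<open>G\<close>, each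
  subgroup is properly contained in the next, so \<open>z \<le> 1 / p ^ 3\<close>.  The right-hand side of the
  recursion grows with \<open>z\<close> once the bound for \<open>D n\<close> is inserted, and at \<open>z = 1 / p ^ 3\<close> the
  recursion with equality, started at 1, is solved exactly by the claimed bound
  (\<open>degree_bound_Suc\<close>).

  The algebraic input is that the sets cut out by \<open>y \<and> a = 1\<close> and by \<open>x \<and> y = 1\<close> are subgroups.
  The defining relations expand a wedge of a product into factors one of which is conjugated by
  an element of \<open>G\<close>, and conjugation preserves triviality of a wedge (\<open>wedge_conj_eq_one\<close>)
  by the universal property of the exterior square.
\<close>

section \<open>Exterior pairings\<close>

lemma wedge_hom:
  "(\<lambda>t. diagonal_closure G #>\<^bsub>tensor_square G\<^esub> t) \<in> hom (tensor_square G) (exterior_square G)"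
  unfolding exterior_square_def by (rule normal.r_coset_hom_Mod[OF diagonal_closure_normal])

lemma wedge_closed:
  assumes "g \<in> carrier G" "h \<in> carrier G"
  shows "wedge G g h \<in> carrier (exterior_square G)"
  unfolding wedge_def using hom_in_carrier[OF wedge_hom tensor_closed[OF assms]] .

lemma wedge_mult_left:
  assumes "group G" "g \<in> carrier G" "h \<in> carrier G" "k \<in> carrier G"
  shows "wedge G (g \<otimes>\<^bsub>G\<^esub> k) h =
    wedge G (conj_by G g k) (conj_by G g h) \<otimes>\<^bsub>exterior_square G\<^esub> wedge G g h"
  unfolding wedge_def
  using assms by (simp add: tensor_mult_left hom_mult[OF wedge_hom] tensor_closed conj_by_closed)

lemma wedge_mult_right:
  assumes "group G" "g \<in> carrier G" "h \<in> carrier G" "k \<in> carrier G"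
  shows "wedge G g (h \<otimes>\<^bsub>G\<^esub> k) =
    wedge G g h \<otimes>\<^bsub>exterior_square G\<^esub> wedge G (conj_by G h g) (conj_by G h k)"
  unfolding wedge_def
  using assms by (simp add: tensor_mult_right hom_mult[OF wedge_hom] tensor_closed conj_by_closed)

lemma wedge_eq_one_iff:
  assumes "g \<in> carrier G" "h \<in> carrier G"
  shows "wedge G g h = \<one>\<^bsub>exterior_square G\<^esub> \<longleftrightarrow> tensor G g h \<in> diagonal_closure G"
proof -
  interpret T: group "tensor_square G" by (rule group_tensor_square)
  interpret N: normal "diagonal_closure G" "tensor_square G" by (rule diagonal_closure_normal)
  have "tensor G g h \<in> carrier (tensor_square G)"
    using assms by (rule tensor_closed)
  then show ?thesis
    using T.coset_join1[OF _ _ N.subgroup_axioms] T.coset_join2[OF _ N.subgroup_axioms]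
    by (auto simp: wedge_def exterior_square_def FactGroup_def)
qed

lemma wedge_self:
  assumes "g \<in> carrier G"
  shows "wedge G g g = \<one>\<^bsub>exterior_square G\<^esub>"
proof -
  have "tensor G g g \<in> diagonal_closure G"
    unfolding diagonal_closure_def using assms by (intro subsetD[OF normal_closure_superset]) blast
  then show ?thesis
    using assms by (simp add: wedge_eq_one_iff)
qed

text \<open>
  This is the universal property of the exterior square: \<open>f\<close> induces a homomorphism from the tensor
  square to \<open>H\<close>, whose kernel is normal and contains the diagonal, hence the diagonal closure.  It
  serves to draw a consequence from \<open>x \<and> y = 1\<close> by exhibiting a pairing that obeys the defining
  relations.
\<close>

lemma exterior_pairing_vanishes:
  assumes "group G" and "group H"
    and closed: "\<And>g h. g \<in> carrier G \<Longrightarrow> h \<in> carrier G \<Longrightarrow> f g h \<in> carrier H"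
    and left: "\<And>g h k. g \<in> carrier G \<Longrightarrow> h \<in> carrier G \<Longrightarrow> k \<in> carrier G \<Longrightarrow>
      f (g \<otimes>\<^bsub>G\<^esub> k) h = f (conj_by G g k) (conj_by G g h) \<otimes>\<^bsub>H\<^esub> f g h"
    and right: "\<And>g h k. g \<in> carrier G \<Longrightarrow> h \<in> carrier G \<Longrightarrow> k \<in> carrier G \<Longrightarrow>
      f g (h \<otimes>\<^bsub>G\<^esub> k) = f g h \<otimes>\<^bsub>H\<^esub> f (conj_by G h g) (conj_by G h k)"
    and diag: "\<And>g. g \<in> carrier G \<Longrightarrow> f g g = \<one>\<^bsub>H\<^esub>"
    and xy: "x \<in> carrier G" "y \<in> carrier G" "wedge G x y = \<one>\<^bsub>exterior_square G\<^esub>"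
  shows "f x y = \<one>\<^bsub>H\<^esub>"
proof -
  interpret G: group G by fact
  interpret H: group H by fact
  let ?T = "tensor_square G"
  let ?f = "\<lambda>(g, h). f g h"
  note cc = conj_by_closed[OF \<open>group G\<close>]
  have "?f \<in> carrier G \<times> carrier G \<rightarrow> carrier H"
    using closed by auto
  moreover have "word_eval H ?f u = word_eval H ?f v" if "(u, v) \<in> tensor_relations G" for u v
    using that left right closed cc unfolding tensor_relations_def by auto
  ultimately obtain \<phi> where hom: "\<phi> \<in> hom ?T H"
    and val: "\<forall>a\<in>carrier G \<times> carrier G.
      \<phi> (pres_gen (carrier G \<times> carrier G) (tensor_relations G) a) = ?f a"
    unfolding tensor_square_def using H.presented_group_hom[of ?f] by metis
  have \<phi>: "\<phi> (tensor G g h) = f g h" if "g \<in> carrier G" "h \<in> carrier G" for g h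
    using val that by (auto simp: tensor_def)
  interpret \<phi>: group_hom ?T H \<phi>
    by (simp add: group_hom_def group_hom_axioms_def hom group_tensor_square \<open>group H\<close>)
  have "{tensor G g g | g. g \<in> carrier G} \<subseteq> kernel ?T H \<phi>"
    using \<phi> diag by (auto simp: kernel_def tensor_closed)
  then have "diagonal_closure G \<subseteq> kernel ?T H \<phi>"
    unfolding diagonal_closure_def normal_closure_def using \<phi>.normal_kernel by blast
  then have "\<phi> (tensor G x y) = \<one>\<^bsub>H\<^esub>"
    using xy by (auto simp: kernel_def wedge_eq_one_iff)
  then show ?thesis
    using xy \<phi> by simp
qed

lemma (in group) inv_cancel_left:
  assumes "x \<in> carrier G" "y \<in> carrier G"
  shows "x \<otimes> (inv x \<otimes> y) = y" "inv x \<otimes> (x \<otimes> y) = y"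
  using assms by (simp_all flip: m_assoc)

text \<open>
  Since conjugation by \<open>k\<close> is an automorphism of \<open>G\<close>, wedging the conjugates of \<open>g\<close> and \<open>h\<close> again
  obeys the relations of an exterior pairing.  The homomorphism that it induces is the action of
  \<open>k\<close> on the exterior square.
\<close>

lemma (in group) wedge_conj_eq_one:
  assumes "k \<in> carrier G"
    and "x \<in> carrier G" "y \<in> carrier G" "wedge G x y = \<one>\<^bsub>exterior_square G\<^esub>"
  shows "wedge G (conj_by G k x) (conj_by G k y) = \<one>\<^bsub>exterior_square G\<^esub>"
proof (rule exterior_pairing_vanishes[where f = "\<lambda>g h. wedge G (conj_by G k g) (conj_by G k h)",
      OF is_group group_exterior_square _ _ _ _ assms(2-4)])
  note cc = conj_by_closed[OF is_group]
  have mult: "conj_by G k (a \<otimes> b) = conj_by G k a \<otimes> conj_by G k b"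
    if "a \<in> carrier G" "b \<in> carrier G" for a b
    using that assms by (simp add: conj_by_def m_assoc inv_cancel_left)
  have conj: "conj_by G k (conj_by G a b) = conj_by G (conj_by G k a) (conj_by G k b)"
    if "a \<in> carrier G" "b \<in> carrier G" for a b
    using that assms by (simp add: conj_by_def m_assoc inv_cancel_left inv_mult_group)
  fix g h l assume "g \<in> carrier G" "h \<in> carrier G" "l \<in> carrier G"
  note ghl = this and simps = mult conj cc \<open>k \<in> carrier G\<close>
  show "wedge G (conj_by G k (g \<otimes> l)) (conj_by G k h) =
      wedge G (conj_by G k (conj_by G g l)) (conj_by G k (conj_by G g h))
        \<otimes>\<^bsub>exterior_square G\<^esub> wedge G (conj_by G k g) (conj_by G k h)"
    using ghl by (simp only: simps) (rule wedge_mult_left[OF is_group]; simp only: simps)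
  show "wedge G (conj_by G k g) (conj_by G k (h \<otimes> l)) =
      wedge G (conj_by G k g) (conj_by G k h) \<otimes>\<^bsub>exterior_square G\<^esub>
        wedge G (conj_by G k (conj_by G h g)) (conj_by G k (conj_by G h l))"
    using ghl by (simp only: simps) (rule wedge_mult_right[OF is_group]; simp only: simps)
qed (simp_all add: wedge_closed wedge_self conj_by_closed[OF is_group] \<open>k \<in> carrier G\<close>)

section \<open>Subgroups cut out by the wedge\<close>

lemma (in group) wedge_one_left:
  assumes "x \<in> carrier G"
  shows "wedge G \<one> x = \<one>\<^bsub>exterior_square G\<^esub>"
proof -
  interpret E: group "exterior_square G" by (rule group_exterior_square)
  show ?thesis
    using wedge_mult_left[OF is_group, of \<one> x \<one>] assms by (simp add: conj_by_def wedge_closed)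
qed

lemma (in group) wedge_one_right:
  assumes "x \<in> carrier G"
  shows "wedge G x \<one> = \<one>\<^bsub>exterior_square G\<^esub>"
proof -
  interpret E: group "exterior_square G" by (rule group_exterior_square)
  show ?thesis
    using wedge_mult_right[OF is_group, of x \<one> \<one>] assms by (simp add: conj_by_def wedge_closed)
qed

text \<open>
  The mirror image of \<^const>\<open>exterior_centralizer\<close>.  Since the exterior center consists of the
  elements whose wedge with every element on their left is trivial, this set is all of \<open>G\<close> exactly
  when \<open>x\<close> lies there; hence the count below uses it rather than the exterior centralizer itself.
\<close>

definition left_exterior_centralizer :: "('a, 'b) monoid_scheme \<Rightarrow> 'a \<Rightarrow> 'a set" where
  "left_exterior_centralizer G x = {y \<in> carrier G. wedge G y x = \<one>\<^bsub>exterior_square G\<^esub>}"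

lemma (in group) subgroup_left_exterior_centralizer:
  assumes x: "x \<in> carrier G"
  shows "subgroup (left_exterior_centralizer G x) G"
proof (rule subgroupI)
  interpret E: group "exterior_square G" by (rule group_exterior_square)
  let ?C = "left_exterior_centralizer G x"
  show "?C \<subseteq> carrier G"
    by (auto simp: left_exterior_centralizer_def)
  show "?C \<noteq> {}"
    using wedge_one_left[OF x] by (auto simp: left_exterior_centralizer_def)
  fix g assume "g \<in> ?C"
  then have g: "g \<in> carrier G" "wedge G g x = \<one>\<^bsub>exterior_square G\<^esub>"
    by (auto simp: left_exterior_centralizer_def)
  \<comment> \<open>Expand \<open>1 = g\<inverse>g \<and> x\<close>: the factor conjugated by \<open>g\<inverse>\<close> vanishes.\<close>
  have "\<one>\<^bsub>exterior_square G\<^esub> = wedge G (conj_by G (inv g) g) (conj_by G (inv g) x)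
      \<otimes>\<^bsub>exterior_square G\<^esub> wedge G (inv g) x"
    using wedge_mult_left[OF is_group, of "inv g" x g] g x wedge_one_left[OF x] by simp
  then show "inv g \<in> ?C"
    using wedge_conj_eq_one[of "inv g" g x] g x wedge_closed[of "inv g" G x]
    by (simp add: left_exterior_centralizer_def)
  fix h assume "h \<in> ?C"
  then have h: "h \<in> carrier G" "wedge G h x = \<one>\<^bsub>exterior_square G\<^esub>"
    by (auto simp: left_exterior_centralizer_def)
  show "g \<otimes> h \<in> ?C"
    using wedge_mult_left[OF is_group g(1) x h(1)] wedge_conj_eq_one[OF g(1) h(1) x h(2)] g h
    by (simp add: left_exterior_centralizer_def)
qed

lemma (in group) subgroup_exterior_centralizer:
  assumes x: "x \<in> carrier G"
  shows "subgroup (exterior_centralizer G x) G"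
proof (rule subgroupI)
  interpret E: group "exterior_square G" by (rule group_exterior_square)
  let ?C = "exterior_centralizer G x"
  show "?C \<subseteq> carrier G"
    by (auto simp: exterior_centralizer_def)
  show "?C \<noteq> {}"
    using wedge_one_right[OF x] by (auto simp: exterior_centralizer_def)
  fix g assume "g \<in> ?C"
  then have g: "g \<in> carrier G" "wedge G x g = \<one>\<^bsub>exterior_square G\<^esub>"
    by (auto simp: exterior_centralizer_def)
  have "\<one>\<^bsub>exterior_square G\<^esub> = wedge G x (inv g)
      \<otimes>\<^bsub>exterior_square G\<^esub> wedge G (conj_by G (inv g) x) (conj_by G (inv g) g)"
    using wedge_mult_right[OF is_group, of x "inv g" g] g x wedge_one_right[OF x] by simp
  then show "inv g \<in> ?C"
    using wedge_conj_eq_one[of "inv g" x g] g x wedge_closed[of x G "inv g"]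
    by (simp add: exterior_centralizer_def)
  fix h assume "h \<in> ?C"
  then have h: "h \<in> carrier G" "wedge G x h = \<one>\<^bsub>exterior_square G\<^esub>"
    by (auto simp: exterior_centralizer_def)
  show "g \<otimes> h \<in> ?C"
    using wedge_mult_right[OF is_group x g(1) h(1)] wedge_conj_eq_one[OF g(1) x h(1) h(2)] g h
    by (simp add: exterior_centralizer_def)
qed

lemma (in group) subgroup_exterior_center: "subgroup (exterior_center G) G"
  unfolding exterior_center_def
  by (rule subgroups_Inter) (auto intro: subgroup_exterior_centralizer)

lemma (in group) subgroup_element_centralizer:
  assumes x: "x \<in> carrier G"
  shows "subgroup {y \<in> carrier G. y \<otimes> x = x \<otimes> y} G"
proof (rule subgroupI)
  fix y assume "y \<in> {y \<in> carrier G. y \<otimes> x = x \<otimes> y}"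
  then have y: "y \<in> carrier G" "y \<otimes> x = x \<otimes> y" by auto
  have "x \<otimes> inv y = inv y \<otimes> (y \<otimes> x) \<otimes> inv y"
    using y(1) x by (simp add: m_assoc inv_cancel_left)
  also have "\<dots> = inv y \<otimes> x"
    using y(1) x by (simp add: y(2) m_assoc)
  finally show "inv y \<in> {y \<in> carrier G. y \<otimes> x = x \<otimes> y}"
    using y(1) by simp
  fix z assume "z \<in> {y \<in> carrier G. y \<otimes> x = x \<otimes> y}"
  then have z: "z \<in> carrier G" "z \<otimes> x = x \<otimes> z" by auto
  have "y \<otimes> z \<otimes> x = y \<otimes> x \<otimes> z"
    using y(1) z(1) x by (simp add: m_assoc z(2))
  also have "\<dots> = x \<otimes> (y \<otimes> z)"
    using y(1) z(1) x by (simp add: y(2)) (simp add: m_assoc)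
  finally show "y \<otimes> z \<in> {y \<in> carrier G. y \<otimes> x = x \<otimes> y}"
    using y(1) z(1) by simp
qed (use x in auto)

lemma (in group) subgroup_group_center: "subgroup (group_center G) G"
proof -
  have "group_center G = (\<Inter>x\<in>carrier G. {y \<in> carrier G. y \<otimes> x = x \<otimes> y})"
    by (auto simp: group_center_def)
  also have "subgroup \<dots> G"
    by (rule subgroups_Inter) (auto intro: subgroup_element_centralizer)
  finally show ?thesis .
qed

section \<open>Indices in terms of the smallest prime divisor\<close>

text \<open>
  By Lagrange the index of \<open>H\<close> in \<open>K\<close> divides the order of \<open>G\<close>, and any prime factor of it is at
  least \<open>p\<close>.
\<close>

lemma (in group) least_prime_times_card_proper_subgroup:
  fixes p :: nat
  assumes fin: "finite (carrier G)"
    and least: "\<forall>q :: nat. Factorial_Ring.prime q \<longrightarrow> q dvd order G \<longrightarrow> p \<le> q"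
    and H: "subgroup H G" and K: "subgroup K G" and "H \<subset> K"
  shows "p * card H \<le> card K"
proof -
  have finK: "finite K"
    using fin K by (meson finite_subset subgroup.subset)
  interpret GK: group "G\<lparr>carrier := K\<rparr>"
    by (rule subgroup_imp_group[OF K])
  define d where "d = card (rcosets\<^bsub>G\<lparr>carrier := K\<rparr>\<^esub> H)"
  have d: "d * card H = card K"
    using GK.lagrange[OF subgroup_incl[OF H K]] \<open>H \<subset> K\<close> by (auto simp: d_def order_def)
  have "card H < card K"
    using \<open>H \<subset> K\<close> finK by (rule psubset_card_mono[rotated])
  then have "d \<noteq> 1"
    using d by auto
  then obtain q :: nat where q: "Factorial_Ring.prime q" "q dvd d"
    using prime_factor_nat by blast
  have "d dvd order G"
    using d lagrange[OF K] by (metis dvd_mult dvd_triv_left)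
  then have "p \<le> q"
    using q least by (meson dvd_trans)
  moreover have "q \<le> d"
    using q(2) d \<open>card H < card K\<close> by (intro dvd_imp_le) (auto intro: Nat.gr0I)
  ultimately have "p * card H \<le> d * card H"
    by simp
  then show ?thesis
    using d by simp
qed

lemma (in group) least_prime_times_card_left_exterior_centralizer:
  fixes p :: nat
  assumes fin: "finite (carrier G)"
    and least: "\<forall>q :: nat. Factorial_Ring.prime q \<longrightarrow> q dvd order G \<longrightarrow> p \<le> q"
    and x: "x \<in> carrier G" "x \<notin> exterior_center G"
  shows "p * card (left_exterior_centralizer G x) \<le> order G"
proof -
  have "left_exterior_centralizer G x \<subset> carrier G"
    using x by (auto simp: left_exterior_centralizer_def exterior_center_def exterior_centralizer_def)
  then show ?thesis
    using least_prime_times_card_proper_subgroup[OF fin least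
        subgroup_left_exterior_centralizer[OF x(1)] subgroup_self]
    by (simp add: order_def)
qed

text \<open>
  The three factors \<open>p\<close> come from the proper inclusions between the exterior center, the center,
  the centralizer of a noncentral element \<open>x\<close> (which contains \<open>x\<close>, so exceeds the center), and \<open>G\<close>.
\<close>

lemma (in group) least_prime_cubed_times_card_exterior_center:
  fixes p :: nat
  assumes fin: "finite (carrier G)"
    and least: "\<forall>q :: nat. Factorial_Ring.prime q \<longrightarrow> q dvd order G \<longrightarrow> p \<le> q"
    and "\<not> comm_group G" and "exterior_center G \<subset> group_center G"
  shows "p ^ 3 * card (exterior_center G) \<le> order G"
proof -
  note index = least_prime_times_card_proper_subgroup[OF fin least]
  have "\<exists>x\<in>carrier G. \<exists>y\<in>carrier G. x \<otimes> y \<noteq> y \<otimes> x"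
    using \<open>\<not> comm_group G\<close> group_comm_groupI by blast
  then obtain x y where xy: "x \<in> carrier G" "y \<in> carrier G" "x \<otimes> y \<noteq> y \<otimes> x"
    by blast
  let ?C = "{z \<in> carrier G. z \<otimes> x = x \<otimes> z}"
  note C = subgroup_element_centralizer[OF xy(1)]
  have "x \<in> ?C" "x \<notin> group_center G" "y \<notin> ?C" "group_center G \<subseteq> ?C"
    using xy by (auto simp: group_center_def)
  then have "group_center G \<subset> ?C" "?C \<subset> carrier G"
    using xy by blast+
  then have "p * card (group_center G) \<le> card ?C" "p * card ?C \<le> order G"
    using index[OF subgroup_group_center C] index[OF C subgroup_self] by (auto simp: order_def)
  moreover have "p * card (exterior_center G) \<le> card (group_center G)"
    using index[OF subgroup_exterior_center subgroup_group_center] assms by blast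
  ultimately have "p * (p * (p * card (exterior_center G))) \<le> order G"
    by (meson mult_le_mono2 order_trans)
  then show ?thesis
    by (simp add: power3_eq_cube mult.assoc)
qed

section \<open>Counting tuples of pairwise related elements\<close>

definition related_tuples :: "('a \<Rightarrow> 'a \<Rightarrow> bool) \<Rightarrow> 'a set \<Rightarrow> nat \<Rightarrow> (nat \<Rightarrow> 'a) set" where
  "related_tuples R A m = {x \<in> {1..m} \<rightarrow>\<^sub>E A. \<forall>i\<in>{1..m}. \<forall>j\<in>{1..m}. R (x i) (x j)}"

lemma finite_related_tuples: "finite A \<Longrightarrow> finite (related_tuples R A m)"
  by (auto simp: related_tuples_def intro!: finite_PiE)

text \<open>
  Split off the last entry \<open>a\<close>.  For \<open>a\<close> in \<open>Z\<close> the remaining entries still form a tuple of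
  related elements; for all other \<open>a\<close> only their relation to \<open>a\<close> is kept, which leaves at most \<open>c\<close>
  choices for each of them.
\<close>

lemma card_related_tuples_Suc_le:
  assumes fin: "finite A" and "Z \<subseteq> A"
    and c: "\<And>a. a \<in> A - Z \<Longrightarrow> card {y \<in> A. R y a} \<le> c"
  shows "card (related_tuples R A (Suc m))
    \<le> card Z * card (related_tuples R A m) + (card A - card Z) * c ^ m"
proof -
  let ?F = "\<lambda>a. if a \<in> Z then related_tuples R A m else {1..m} \<rightarrow>\<^sub>E {y \<in> A. R y a}"
  let ?split = "\<lambda>x. (x (Suc m), restrict x {1..m})"
  have finF: "\<forall>a\<in>A. finite (?F a)"
    using fin by (auto simp: finite_related_tuples intro!: finite_PiE)
  have finZ: "finite Z"
    using fin \<open>Z \<subseteq> A\<close> by (rule rev_finite_subset)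
  have inj: "inj_on ?split (related_tuples R A (Suc m))"
  proof (rule inj_onI)
    fix x y assume xy: "x \<in> related_tuples R A (Suc m)" "y \<in> related_tuples R A (Suc m)"
      and eq: "?split x = ?split y"
    show "x = y"
    proof (rule PiE_ext)
      show "x \<in> {1..Suc m} \<rightarrow>\<^sub>E A" "y \<in> {1..Suc m} \<rightarrow>\<^sub>E A"
        using xy by (auto simp: related_tuples_def)
      fix i assume "i \<in> {1..Suc m}"
      then consider "i = Suc m" | "i \<in> {1..m}" by force
      then show "x i = y i"
        using eq by cases (auto dest: fun_cong[of _ _ i])
    qed
  qed
  have "?split ` related_tuples R A (Suc m) \<subseteq> Sigma A ?F"
    by (auto simp: related_tuples_def PiE_iff)
  then have "card (related_tuples R A (Suc m)) \<le> card (Sigma A ?F)"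
    using fin finF by (intro card_inj_on_le[OF inj]) (auto intro: finite_SigmaI)
  also have "\<dots> = (\<Sum>a\<in>A. card (?F a))"
    using fin finF by (rule card_SigmaI)
  also have "\<dots> = (\<Sum>a\<in>Z. card (?F a)) + (\<Sum>a\<in>A - Z. card (?F a))"
    using sum.subset_diff[OF \<open>Z \<subseteq> A\<close> fin] by (simp only: add.commute)
  also have "\<dots> \<le> (\<Sum>a\<in>Z. card (related_tuples R A m)) + (\<Sum>a\<in>A - Z. c ^ m)"
    using c by (intro add_mono sum_mono) (auto simp: card_PiE intro: power_mono)
  also have "\<dots> = card Z * card (related_tuples R A m) + (card A - card Z) * c ^ m"
    using \<open>Z \<subseteq> A\<close> finZ by (simp add: card_Diff_subset)
  finally show ?thesis .
qed

section \<open>Solving the recursion\<close>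

definition degree_bound :: "real \<Rightarrow> nat \<Rightarrow> real" where
  "degree_bound p n = (p ^ (2 * n + 1) * (p + 1) + p ^ (2 * n) - 1) / (p ^ (3 * n + 1) * (p + 1))"

lemma degree_bound_0:
  assumes "p > 0"
  shows "degree_bound p 0 = 1"
  using assms by (simp add: degree_bound_def)

lemma degree_bound_Suc:
  assumes "p > 0"
  shows "degree_bound p (Suc n) = (1 / p ^ 3) * degree_bound p n + (1 - 1 / p ^ 3) * (1 / p) ^ Suc n"
proof -
  define q where "q = p ^ n"
  have q: "p ^ (n * 2) = q * q" "p ^ (n * 3) = q * q * q" "p ^ n = q" "q > 0" "p + 1 \<noteq> 0" "p \<noteq> 0"
    using assms by (simp_all add: q_def power_mult power2_eq_square power3_eq_cube)
  show ?thesis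
    using q unfolding degree_bound_def
    by (simp add: power_add power_one_over divide_simps mult.commute[of _ n])
       (simp add: algebra_simps power2_eq_square power3_eq_cube power4_eq_xxxx)
qed

text \<open>
  This makes \<open>z * degree_bound p n + (1 - z) * (1 / p) ^ Suc n\<close> nondecreasing in \<open>z\<close>.
\<close>

lemma degree_bound_ge:
  assumes "p \<ge> 1"
  shows "(1 / p) ^ Suc n \<le> degree_bound p n"
proof (induction n)
  case 0
  then show ?case using assms by (simp add: degree_bound_0)
next
  case (Suc n)
  have "(1 / p) ^ Suc (Suc n) \<le> (1 / p) ^ Suc n"
    using assms by (intro power_decreasing) auto
  also have "\<dots> = (1 / p ^ 3) * (1 / p) ^ Suc n + (1 - 1 / p ^ 3) * (1 / p) ^ Suc n"
    by (simp add: algebra_simps)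
  also have "\<dots> \<le> degree_bound p (Suc n)"
    using Suc assms by (simp only: degree_bound_Suc) (intro add_right_mono mult_left_mono, auto)
  finally show ?case .
qed

text \<open>
  The two hypotheses on cardinalities supply the upper bounds \<open>1 / p ^ 3\<close> for \<open>|Z| / |A|\<close> and
  \<open>|A| / p\<close> for \<open>c\<close> that turn \<open>card_related_tuples_Suc_le\<close> into the recursion of \<open>degree_bound\<close>.
\<close>

lemma card_related_tuples_le_degree_bound:
  fixes p :: nat
  assumes fin: "finite A" and "p \<ge> 1" and "Z \<subseteq> A"
    and Z: "p ^ 3 * card Z \<le> card A"
    and R: "\<And>a. a \<in> A - Z \<Longrightarrow> p * card {y \<in> A. R y a} \<le> card A"
  shows "real (card (related_tuples R A (Suc n))) \<le> degree_bound p n * real (card A) ^ Suc n"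
proof (induction n)
  case 0
  have "card (related_tuples R A (Suc 0)) \<le> card ({1..Suc 0} \<rightarrow>\<^sub>E A)"
    using fin by (intro card_mono finite_PiE) (auto simp: related_tuples_def)
  then show ?case
    using \<open>p \<ge> 1\<close> by (simp add: card_PiE degree_bound_0)
next
  case (Suc n)
  define a where "a = real (card A)"
  define z where "z = real (card Z)"
  define r where "r = (1 / real p) ^ Suc n"
  define b where "b = degree_bound p n"
  have "card Z \<le> card A"
    using fin \<open>Z \<subseteq> A\<close> by (rule card_mono)
  then have z: "0 \<le> z" "z \<le> a"
    by (simp_all add: a_def z_def)
  have "real (p ^ 3 * card Z) \<le> a"
    unfolding a_def using Z by (simp only: of_nat_le_iff)
  then have z3: "z \<le> a * (1 / real p ^ 3)"
    using \<open>p \<ge> 1\<close> by (simp add: z_def field_simps)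
  have "card {y \<in> A. R y x} \<le> card A div p" if "x \<in> A - Z" for x
    using R[OF that] \<open>p \<ge> 1\<close> by (simp add: less_eq_div_iff_mult_less_eq mult.commute)
  note card_related_tuples_Suc_le[OF fin \<open>Z \<subseteq> A\<close> this, where m = "Suc n"]
  then have "real (card (related_tuples R A (Suc (Suc n))))
      \<le> real (card Z * card (related_tuples R A (Suc n)) + (card A - card Z) * (card A div p) ^ Suc n)"
    by (simp only: of_nat_le_iff)
  also have "\<dots> = z * real (card (related_tuples R A (Suc n))) + (a - z) * real (card A div p) ^ Suc n"
    using \<open>card Z \<le> card A\<close> by (simp add: a_def z_def of_nat_diff)
  also have "\<dots> \<le> z * (b * a ^ Suc n) + (a - z) * (a / real p) ^ Suc n"
    using z Suc of_nat_div_le_of_nat[of "card A" p, where ?'a = real]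
    by (intro add_mono mult_left_mono power_mono) (auto simp: a_def b_def)
  also have "\<dots> = (z * (b - r) + a * r) * a ^ Suc n"
  proof -
    have "(a / real p) ^ Suc n = r * a ^ Suc n"
      by (simp add: r_def power_divide)
    then show ?thesis
      by (simp only:) (simp only: algebra_simps)
  qed
  \<comment> \<open>The bracket grows with \<open>z\<close>, so the largest admissible \<open>z\<close> may be inserted.\<close>
  also have "\<dots> \<le> (a * (1 / real p ^ 3) * (b - r) + a * r) * a ^ Suc n"
    using z3 degree_bound_ge[of "real p" n] \<open>p \<ge> 1\<close>
    by (intro mult_right_mono add_right_mono) (auto simp: b_def r_def a_def)
  also have "\<dots> = degree_bound p (Suc n) * a ^ Suc (Suc n)"
  proof -
    have "degree_bound p (Suc n) = (1 / real p ^ 3) * b + (1 - 1 / real p ^ 3) * r"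
      using \<open>p \<ge> 1\<close> unfolding b_def r_def by (intro degree_bound_Suc) simp
    then show ?thesis
      by (simp only: power_Suc[of a "Suc n"]) (simp only: algebra_simps mult_1_left)
  qed
  finally show ?case
    by (simp only: a_def)
qed

section \<open>The bound for the multiple exterior degree\<close>

theorem theorem3p8:
  fixes G :: "('a, 'b) monoid_scheme" and p n :: nat
  assumes "group G" and "finite (carrier G)" and "\<not> comm_group G"
    and "Factorial_Ring.prime p" and "p dvd order G"
    and "\<And>q :: nat. Factorial_Ring.prime q \<Longrightarrow> q dvd order G \<Longrightarrow> p \<le> q"
    and "exterior_center G \<subset> group_center G"
    and "n \<ge> 1"
  shows "multiple_exterior_degree n G
    \<le> (real p ^ (2 * n + 1) * (real p + 1) + real p ^ (2 * n) - 1)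
        / (real p ^ (3 * n + 1) * (real p + 1))"
proof -
  interpret group G by fact
  let ?R = "\<lambda>x y. wedge G x y = \<one>\<^bsub>exterior_square G\<^esub>"
  have least: "\<forall>q :: nat. Factorial_Ring.prime q \<longrightarrow> q dvd order G \<longrightarrow> p \<le> q"
    using assms(6) by blast
  have "p \<ge> 1"
    using assms(4) prime_ge_1_nat by blast
  have "card (carrier G) > 0"
    using assms(2) by (auto simp: card_gt_0_iff)
  have "real (card (related_tuples ?R (carrier G) (Suc n)))
      \<le> degree_bound p n * real (card (carrier G)) ^ Suc n"
  proof (rule card_related_tuples_le_degree_bound[where Z = "exterior_center G"])
    show "exterior_center G \<subseteq> carrier G"
      by (rule subgroup.subset[OF subgroup_exterior_center])
    show "p ^ 3 * card (exterior_center G) \<le> card (carrier G)"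
      using least_prime_cubed_times_card_exterior_center[OF assms(2) least assms(3,7)] by (simp add: order_def)
    show "p * card {y \<in> carrier G. ?R y a} \<le> card (carrier G)"
      if "a \<in> carrier G - exterior_center G" for a
      using least_prime_times_card_left_exterior_centralizer[OF assms(2) least] that
      by (simp add: order_def left_exterior_centralizer_def)
  qed fact+
  then have "multiple_exterior_degree n G \<le> degree_bound p n"
    using \<open>card (carrier G) > 0\<close>
    by (simp add: multiple_exterior_degree_def related_tuples_def order_def pos_divide_le_eq)
  then show ?thesis
    by (simp add: degree_bound_def)
qed

end
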